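(* Let $V$ be a real vector space endowed with a partial order $\preceq$ making it an ordered vector space, let $X\subseteq V$ be a convex cone, let $\mathbf{C}\subseteq X\times X$ be a convex-conic symmetric preorder on $X$, and let $(\mathbb{V},\leq)$ be a Dedekind-complete Riesz space. Let $H:X\to \mathbb{V}\cup\{-\infty\}$ be $\mathbf{C}$-sublinear and monotone, and let $Y\subseteq X$ be a convex cone. If $\ell:Y\to \mathbb{V}\cup\{-\infty\}$ is $\mathbf{C}$-linear and satisfies $\ell(y)\leq H(y)$ for all $y\in Y$, then there exists a $\mathbf{C}$-linear map $Q:X\to \mathbb{V}\cup\{-\infty\}$ such that $Q(x)\leq H(x)$ for all $x\in X$ and $\ell(y)\leq Q(y)$ for all $y\in Y$.
   Context: All vector spaces are real. A subset $X$ of a vector space $V$ is a convex cone if $\lambda X\subseteq X$ for all $\lambda>0$ and $X+X\subseteq X$ (so $0$ need not belong to $X$). A binary relation $\mathbf{C}\subseteq X\times X$ on a convex cone $X$ (write $x\mathbf{C}y$ for $(x,y)\in\mathbf{C}$) is a convex-conic symmetric preorder if it is reflexive, transitive, symmetric, and satisfies: (i) $(\lambda x)\mathbf{C}x$ for all $x\in X$ and $\lambda>0$; (ii) for all $x,y,z\in X$, if $x\mathbf{C}y$ and $y\mathbf{C}z$, then $(x+y)\mathbf{C}z$. An ordered vector space is a vector space with a partial order compatible with addition and with multiplication by nonnegative scalars. A Riesz space is an ordered vector space that is a lattice; it is Dedekind-complete if each (nonempty) subset that is bounded from above has a supremum. The element $-\infty$ is adjoined to $\mathbb{V}$ with $-\infty\leq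 v$ for all $v\in\mathbb{V}$, with the usual arithmetic $v+(-\infty)=(-\infty)+v=-\infty$ for all $v\in\mathbb{V}\cup\{-\infty\}$, $\lambda\cdot(-\infty)=-\infty$ for $\lambda>0$, and the convention $0\cdot(-\infty)=0_{\mathbb{V}}$. For a convex cone $Z\subseteq X$ (in particular $Z=X$ or $Z=Y$), a map $F:Z\to\mathbb{V}\cup\{-\infty\}$ is positively homogeneous if $F(\lambda x)=\lambda F(x)$ for all $\lambda>0$ and $x\in Z$. It is $\mathbf{C}$-sublinear (respectively $\mathbf{C}$-linear) if it is positively homogeneous and $F(x+y)\leq F(x)+F(y)$ (respectively $=$) for all $x,y\in Z$ with $x\mathbf{C}y$. A map $F:X\to\mathbb{V}\cup\{-\infty\}$ is monotone if $x\preceq y$ implies $F(x)\leq F(y)$ for all $x,y\in X$. *)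

theory Defs
  imports Complex_Main
begin

text \<open>The set obtained from a vector space by adjoining one least element.\<close>

datatype 'a minf_ext = MInf | Fin 'a

instantiation minf_ext :: (order) order_bot
begin

fun less_eq_minf_ext :: "'a minf_ext \<Rightarrow> 'a minf_ext \<Rightarrow> bool" where
  "less_eq_minf_ext MInf b = True"
| "less_eq_minf_ext (Fin a) MInf = False"
| "less_eq_minf_ext (Fin a) (Fin b) = (a \<le> b)"

definition less_minf_ext :: "'a minf_ext \<Rightarrow> 'a minf_ext \<Rightarrow> bool" where
  "less_minf_ext a b \<longleftrightarrow> a \<le> b \<and> \<not> b \<le> a"

definition bot_minf_ext :: "'a minf_ext" where
  "bot_minf_ext = MInf"

instance
proof
  fix x y z :: "'a minf_ext"
  show "x < y \<longleftrightarrow> x \<le> y \<and> \<not> y \<le> x" by (simp add: less_minf_ext_def)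
  show "x \<le> x" by (cases x) simp_all
  show "x \<le> z" if "x \<le> y" "y \<le> z" using that by (cases x; cases y; cases z) simp_all
  show "x = y" if "x \<le> y" "y \<le> x" using that by (cases x; cases y) simp_all
  show "bot \<le> x" by (simp add: bot_minf_ext_def)
qed

end

instantiation minf_ext :: (comm_monoid_add) comm_monoid_add
begin

definition zero_minf_ext :: "'a minf_ext" where
  "zero_minf_ext = Fin 0"

fun plus_minf_ext :: "'a minf_ext \<Rightarrow> 'a minf_ext \<Rightarrow> 'a minf_ext" where
  "plus_minf_ext (Fin a) (Fin b) = Fin (a + b)"
| "plus_minf_ext MInf b = MInf"
| "plus_minf_ext a MInf = MInf"

instance
proof
  fix a b c :: "'a minf_ext"
  show "a + b + c = a + (b + c)" by (cases a; cases b; cases c) (simp_all add: add.assoc)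
  show "a + b = b + a" by (cases a; cases b) (simp_all add: add.commute)
  show "0 + a = a" by (cases a) (simp_all add: zero_minf_ext_def)
qed

end

text \<open>Only scalars \<open>c \<ge> 0\<close> are meaningful on \<open>MInf\<close>; for \<open>c < 0\<close> the value is a dummy.\<close>

instantiation minf_ext :: (real_vector) scaleR
begin

fun scaleR_minf_ext :: "real \<Rightarrow> 'a minf_ext \<Rightarrow> 'a minf_ext" where
  "scaleR_minf_ext c (Fin a) = Fin (c *\<^sub>R a)"
| "scaleR_minf_ext c MInf = (if c = 0 then Fin 0 else MInf)"

instance ..

end

text \<open>Neither nonemptiness nor membership of \<open>0\<close> is required, in contrast to the
  constant \<open>convex_cone\<close> of \<open>HOL-Analysis\<close>.\<close>

definition is_convex_cone :: "'v::real_vector set \<Rightarrow> bool" where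
  "is_convex_cone X \<longleftrightarrow>
     (\<forall>c>0. \<forall>x\<in>X. c *\<^sub>R x \<in> X) \<and> (\<forall>x\<in>X. \<forall>y\<in>X. x + y \<in> X)"

definition convex_conic_sym_preorder :: "'v::real_vector set \<Rightarrow> 'v rel \<Rightarrow> bool" where
  "convex_conic_sym_preorder X C \<longleftrightarrow>
     C \<subseteq> X \<times> X \<and> refl_on X C \<and> trans C \<and> sym C \<and>
     (\<forall>x\<in>X. \<forall>c>0. (c *\<^sub>R x, x) \<in> C) \<and>
     (\<forall>x\<in>X. \<forall>y\<in>X. \<forall>z\<in>X. (x, y) \<in> C \<longrightarrow> (y, z) \<in> C \<longrightarrow> (x + y, z) \<in> C)"

text \<open>Maps on a cone \<open>Z\<close> are total functions of which only the values on \<open>Z\<close> matter.\<close>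

definition pos_homogeneous_on ::
  "'v::real_vector set \<Rightarrow> ('v \<Rightarrow> 'w::real_vector minf_ext) \<Rightarrow> bool" where
  "pos_homogeneous_on Z F \<longleftrightarrow> (\<forall>c>0. \<forall>x\<in>Z. F (c *\<^sub>R x) = c *\<^sub>R F x)"

definition rel_sublinear_on ::
  "'v::real_vector rel \<Rightarrow> 'v set \<Rightarrow> ('v \<Rightarrow> 'w::ordered_real_vector minf_ext) \<Rightarrow> bool" where
  "rel_sublinear_on C Z F \<longleftrightarrow> pos_homogeneous_on Z F \<and>
     (\<forall>x\<in>Z. \<forall>y\<in>Z. (x, y) \<in> C \<longrightarrow> F (x + y) \<le> F x + F y)"

definition rel_linear_on ::
  "'v::real_vector rel \<Rightarrow> 'v set \<Rightarrow> ('v \<Rightarrow> 'w::real_vector minf_ext) \<Rightarrow> bool" where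
  "rel_linear_on C Z F \<longleftrightarrow> pos_homogeneous_on Z F \<and>
     (\<forall>x\<in>Z. \<forall>y\<in>Z. (x, y) \<in> C \<longrightarrow> F (x + y) = F x + F y)"

end

theory Submission imports Defs begin

text \<open>
  The equivalence classes of \<open>C\<close> are convex cones on which \<open>C\<close> imposes no restriction, and
  different classes do not interact; so it suffices to prove a sandwich theorem on a single
  convex cone \<open>K\<close>, with \<open>l\<close> extended by \<open>-\<infinity>\<close> to a superlinear map \<open>T\<close>. By Zorn's lemma there
  is a minimal sublinear \<open>P\<close> with \<open>T \<le> P \<le> H\<close>. For a superlinear \<open>g\<close> on a subcone \<open>U\<close> with
  \<open>P (x + u) \<ge> T x + g u\<close>, the infimum of \<open>P x\<close> and of all \<open>P (x + u) - g u\<close> is again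
  sublinear and above \<open>T\<close>, so minimality gives \<open>P (x + u) \<ge> P x + g u\<close>. Taking first \<open>g = T\<close>, and
  then, with the inequality so obtained, \<open>g = P\<close> on the ray through a point, shows that \<open>P\<close> is
  additive.
\<close>

section \<open>Order, arithmetic and infima in the extended space\<close>

lemma le_MInf_iff [simp]: "a \<le> MInf \<longleftrightarrow> a = (MInf :: 'a::order minf_ext)"
  by (cases a) simp_all

lemma plus_MInf_right [simp]: "a + MInf = (MInf :: 'a::comm_monoid_add minf_ext)"
  by (cases a) simp_all

lemma minf_ext_add_mono:
  fixes a b c d :: "'a::ordered_comm_monoid_add minf_ext"
  assumes "a \<le> b" "c \<le> d"
  shows "a + c \<le> b + d"
  using assms by (cases a; cases b; cases c; cases d) (simp_all add: add_mono)

lemma minf_ext_add_Fin_le_iff: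
  fixes a b :: "'a::ordered_ab_group_add minf_ext"
  shows "a + Fin m \<le> b \<longleftrightarrow> a \<le> b + Fin (- m)"
  by (cases a; cases b) (simp_all add: le_diff_eq)

lemma minf_ext_scaleR_scaleR:
  fixes a :: "'a::real_vector minf_ext"
  assumes "c > 0" "d > 0"
  shows "c *\<^sub>R d *\<^sub>R a = (c * d) *\<^sub>R a"
  using assms by (cases a) simp_all

lemma minf_ext_scaleR_one [simp]: "1 *\<^sub>R a = (a :: 'a::real_vector minf_ext)"
  by (cases a) simp_all

lemma minf_ext_scaleR_add:
  fixes a b :: "'a::real_vector minf_ext"
  assumes "c > 0"
  shows "c *\<^sub>R (a + b) = c *\<^sub>R a + c *\<^sub>R b"
  using assms by (cases a; cases b) (simp_all add: scaleR_add_right)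

lemma minf_ext_scaleR_left_mono:
  fixes a b :: "'a::ordered_real_vector minf_ext"
  assumes "c > 0" "a \<le> b"
  shows "c *\<^sub>R a \<le> c *\<^sub>R b"
  using assms by (cases a; cases b) (simp_all add: scaleR_left_mono)

text \<open>A finite lower bound excludes \<open>MInf\<close> from \<open>A\<close>, so only finite
  members matter then, and \<open>Inf\<close> is applied to a set bounded below. For empty
  \<open>A\<close> the value is the uninformative \<open>Fin (Inf {})\<close>, hence the
  nonemptiness assumptions below.\<close>

definition minf_Inf :: "'a::conditionally_complete_lattice minf_ext set \<Rightarrow> 'a minf_ext" where
  "minf_Inf A = (if \<exists>m. \<forall>a\<in>A. Fin m \<le> a then Fin (Inf {a. Fin a \<in> A}) else MInf)"

lemma minf_Inf_lower:
  assumes "a \<in> A"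
  shows "minf_Inf A \<le> a"
proof (cases "\<exists>m. \<forall>a\<in>A. Fin m \<le> a")
  case True
  then obtain m where m: "\<And>a. a \<in> A \<Longrightarrow> Fin m \<le> a" by blast
  obtain b where b: "a = Fin b" using m[OF assms] by (cases a) simp_all
  have "bdd_below {a. Fin a \<in> A}" using m by (intro bdd_belowI[of _ m]) fastforce
  with True b assms show ?thesis by (simp add: minf_Inf_def cInf_lower)
qed (auto simp: minf_Inf_def)

lemma minf_Inf_greatest:
  assumes "A \<noteq> {}" "\<And>a. a \<in> A \<Longrightarrow> b \<le> a"
  shows "b \<le> minf_Inf A"
proof (cases b)
  case (Fin m)
  obtain a where a: "a \<in> A" using assms(1) by blast
  obtain a' where "a = Fin a'" using assms(2)[OF a] Fin by (cases a) simp_all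
  with a have "{a. Fin a \<in> A} \<noteq> {}" by blast
  moreover have "m \<le> a" if "Fin a \<in> A" for a using assms(2)[OF that] Fin by simp
  ultimately have "m \<le> Inf {a. Fin a \<in> A}" by (intro cInf_greatest) auto
  moreover have "\<exists>m. \<forall>a\<in>A. Fin m \<le> a" using assms(2) Fin by blast
  ultimately show ?thesis using Fin by (simp add: minf_Inf_def)
qed simp

text \<open>The infima are taken one at a time: for fixed \<open>b\<close>, \<open>c - b\<close>
  bounds \<open>A\<close> from below, hence \<open>c - minf_Inf A\<close> bounds \<open>B\<close>
  from below. The differences make sense because a finite \<open>c\<close> forces the members of
  \<open>B\<close> and then \<open>minf_Inf A\<close> to be finite.\<close>

lemma le_minf_Inf_add:
  fixes A B :: "'a::{ordered_ab_group_add, conditionally_complete_lattice} minf_ext set"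
  assumes "A \<noteq> {}" "B \<noteq> {}" and le: "\<And>a b. a \<in> A \<Longrightarrow> b \<in> B \<Longrightarrow> c \<le> a + b"
  shows "c \<le> minf_Inf A + minf_Inf B"
proof (cases c)
  case (Fin m)
  have *: "Fin (m - b) \<le> a \<longleftrightarrow> c \<le> a + Fin b" for a b
    using Fin minf_ext_add_Fin_le_iff[of c "- b" a] by simp
  have "Fin (m - b) \<le> minf_Inf A" if "Fin b \<in> B" for b
    using assms(1) le[OF _ that] by (intro minf_Inf_greatest) (auto simp: *)
  then have 1: "c \<le> minf_Inf A + Fin b" if "Fin b \<in> B" for b
    using that * by blast
  have fin: "\<exists>b'. b = Fin b'" if "b \<in> B" for b
    using le[OF _ that] assms(1) Fin by (cases b) auto
  obtain \<alpha> where \<alpha>: "minf_Inf A = Fin \<alpha>"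
    using assms(2) fin 1 Fin by (cases "minf_Inf A") fastforce+
  have "Fin (m - \<alpha>) \<le> minf_Inf B"
  proof (rule minf_Inf_greatest[OF assms(2)])
    fix b assume "b \<in> B"
    with fin 1 show "Fin (m - \<alpha>) \<le> b" by (metis * \<alpha> add.commute)
  qed
  then show ?thesis by (simp add: * \<alpha> add.commute)
qed simp

section \<open>Homogeneity and sublinearity on convex cones\<close>

lemma is_convex_cone_scaleR: "is_convex_cone K \<Longrightarrow> c > 0 \<Longrightarrow> x \<in> K \<Longrightarrow> c *\<^sub>R x \<in> K"
  by (simp add: is_convex_cone_def)

lemma is_convex_cone_add: "is_convex_cone K \<Longrightarrow> x \<in> K \<Longrightarrow> y \<in> K \<Longrightarrow> x + y \<in> K"
  by (simp add: is_convex_cone_def)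

text \<open>The reverse inequality is the assumed one for the factor \<open>inverse c\<close> at the
  point \<open>c *\<^sub>R x\<close>.\<close>

lemma pos_homogeneous_onI:
  fixes F :: "'v::real_vector \<Rightarrow> 'w::ordered_real_vector minf_ext"
  assumes K: "is_convex_cone K"
    and le: "\<And>c x. c > 0 \<Longrightarrow> x \<in> K \<Longrightarrow> F (c *\<^sub>R x) \<le> c *\<^sub>R F x"
  shows "pos_homogeneous_on K F"
  unfolding pos_homogeneous_on_def
proof (intro allI impI ballI antisym)
  fix c :: real and x assume c: "c > 0" and x: "x \<in> K"
  show "F (c *\<^sub>R x) \<le> c *\<^sub>R F x" using le c x .
  have "F (inverse c *\<^sub>R c *\<^sub>R x) \<le> inverse c *\<^sub>R F (c *\<^sub>R x)"
    using K c x by (intro le) (auto simp: is_convex_cone_def)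
  then have "F x \<le> inverse c *\<^sub>R F (c *\<^sub>R x)" using c by simp
  then have "c *\<^sub>R F x \<le> c *\<^sub>R inverse c *\<^sub>R F (c *\<^sub>R x)"
    by (rule minf_ext_scaleR_left_mono[OF c])
  then show "c *\<^sub>R F x \<le> F (c *\<^sub>R x)" using c by (simp add: minf_ext_scaleR_scaleR)
qed

text \<open>Covers both infima needed later: that of shifted values of one map, and that of a chain
  of maps. The relation \<open>UNIV\<close> expresses sublinearity for all pairs.\<close>

lemma rel_sublinear_on_minf_Inf:
  fixes A :: "'v::real_vector \<Rightarrow> 'w::{ordered_real_vector, conditionally_complete_lattice} minf_ext set"
  assumes K: "is_convex_cone K"
    and ne: "\<And>x. x \<in> K \<Longrightarrow> A x \<noteq> {}"
    and scale: "\<And>c x a. c > 0 \<Longrightarrow> x \<in> K \<Longrightarrow> a \<in> A x \<Longrightarrow> c *\<^sub>R a \<in> A (c *\<^sub>R x)"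
    and add: "\<And>x y a b. x \<in> K \<Longrightarrow> y \<in> K \<Longrightarrow> a \<in> A x \<Longrightarrow> b \<in> A y \<Longrightarrow> \<exists>d\<in>A (x + y). d \<le> a + b"
    and F: "\<And>x. x \<in> K \<Longrightarrow> F x = minf_Inf (A x)"
  shows "rel_sublinear_on UNIV K F"
proof -
  note KcI = is_convex_cone_scaleR[OF K]
  note KaI = is_convex_cone_add[OF K]
  have "pos_homogeneous_on K F"
  proof (rule pos_homogeneous_onI[OF K])
    fix c :: real and x assume c: "c > 0" and x: "x \<in> K"
    have "inverse c *\<^sub>R F (c *\<^sub>R x) \<le> F x"
      unfolding F[OF x]
    proof (rule minf_Inf_greatest[OF ne[OF x]])
      fix a assume "a \<in> A x"
      then have "F (c *\<^sub>R x) \<le> c *\<^sub>R a"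
        unfolding F[OF KcI[OF c x]] by (intro minf_Inf_lower scale c x)
      then have "inverse c *\<^sub>R F (c *\<^sub>R x) \<le> inverse c *\<^sub>R c *\<^sub>R a"
        using c by (intro minf_ext_scaleR_left_mono) auto
      then show "inverse c *\<^sub>R F (c *\<^sub>R x) \<le> a" using c by (simp add: minf_ext_scaleR_scaleR)
    qed
    then have "c *\<^sub>R inverse c *\<^sub>R F (c *\<^sub>R x) \<le> c *\<^sub>R F x"
      by (rule minf_ext_scaleR_left_mono[OF c])
    then show "F (c *\<^sub>R x) \<le> c *\<^sub>R F x" using c by (simp add: minf_ext_scaleR_scaleR)
  qed
  moreover have "F (x + y) \<le> F x + F y" if x: "x \<in> K" and y: "y \<in> K" for x y
    unfolding F[OF x] F[OF y] F[OF KaI[OF x y]]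
    by (rule le_minf_Inf_add[OF ne[OF x] ne[OF y]]) (meson add x y minf_Inf_lower order_trans)
  ultimately show ?thesis by (simp add: rel_sublinear_on_def)
qed

section \<open>Minimal sublinear maps are additive\<close>

definition sublinear_above ::
  "'v::real_vector set \<Rightarrow> ('v \<Rightarrow> 'w::ordered_real_vector minf_ext) \<Rightarrow> ('v \<Rightarrow> 'w minf_ext) \<Rightarrow> bool" where
  "sublinear_above K T P \<longleftrightarrow> rel_sublinear_on UNIV K P \<and> (\<forall>x\<in>K. T x \<le> P x)"

text \<open>Maps are compared on \<open>K\<close> only, their values elsewhere being arbitrary. No
  upper bound is imposed: a competitor below \<open>P\<close> inherits every upper bound of
  \<open>P\<close>.\<close>

definition minimal_sublinear_above ::
  "'v::real_vector set \<Rightarrow> ('v \<Rightarrow> 'w::ordered_real_vector minf_ext) \<Rightarrow> ('v \<Rightarrow> 'w minf_ext) \<Rightarrow> bool" where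
  "minimal_sublinear_above K T P \<longleftrightarrow> sublinear_above K T P \<and>
     (\<forall>R. sublinear_above K T R \<longrightarrow> (\<forall>x\<in>K. R x \<le> P x) \<longrightarrow> (\<forall>x\<in>K. P x \<le> R x))"

text \<open>Lowering \<open>P\<close> to the infimum of its values shifted along \<open>U\<close>
  and corrected by \<open>g\<close> keeps it sublinear and above \<open>T\<close>, so by minimality
  nothing was lowered. The map \<open>g\<close> takes finite values so that it can be
  subtracted.\<close>

lemma minimal_sublinear_superadditive:
  fixes P T :: "'v::real_vector \<Rightarrow> 'w::{ordered_real_vector, conditionally_complete_lattice} minf_ext"
    and g :: "'v \<Rightarrow> 'w"
  assumes K: "is_convex_cone K"
    and minimal: "minimal_sublinear_above K T P"
    and U: "is_convex_cone U" "U \<subseteq> K"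
    and gc: "\<And>c u. c > 0 \<Longrightarrow> u \<in> U \<Longrightarrow> g (c *\<^sub>R u) = c *\<^sub>R g u"
    and ga: "\<And>u v. u \<in> U \<Longrightarrow> v \<in> U \<Longrightarrow> g u + g v \<le> g (u + v)"
    and gT: "\<And>x u. x \<in> K \<Longrightarrow> u \<in> U \<Longrightarrow> T x + Fin (g u) \<le> P (x + u)"
    and x: "x \<in> K" and u: "u \<in> U"
  shows "P x + Fin (g u) \<le> P (x + u)"
proof -
  have P: "sublinear_above K T P"
    and min: "\<And>R. sublinear_above K T R \<Longrightarrow> \<forall>x\<in>K. R x \<le> P x \<Longrightarrow> \<forall>x\<in>K. P x \<le> R x"
    using minimal by (simp_all add: minimal_sublinear_above_def)
  note KcI = is_convex_cone_scaleR[OF K]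
  note KaI = is_convex_cone_add[OF K]
  note UcI = is_convex_cone_scaleR[OF U(1)]
  note UaI = is_convex_cone_add[OF U(1)]
  have UK: "u \<in> K" if "u \<in> U" for u using U that by blast
  have Pc: "P (c *\<^sub>R x) = c *\<^sub>R P x" if "c > 0" "x \<in> K" for c x
    using P that by (auto simp: sublinear_above_def rel_sublinear_on_def pos_homogeneous_on_def)
  have Pa: "P (x + y) \<le> P x + P y" if "x \<in> K" "y \<in> K" for x y
    using P that by (auto simp: sublinear_above_def rel_sublinear_on_def)
  \<comment> \<open>\<open>P x\<close> is inserted because \<open>0\<close> need not belong to
    \<open>U\<close>; it keeps the infimum below \<open>P\<close>.\<close>
  define A where "A x = insert (P x) ((\<lambda>u. P (x + u) + Fin (- g u)) ` U)" for x
  have "rel_sublinear_on UNIV K (\<lambda>x. minf_Inf (A x))"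
  proof (rule rel_sublinear_on_minf_Inf[OF K, where A = A])
    fix c :: real and x a assume c: "c > 0" and x: "x \<in> K" and "a \<in> A x"
    then consider "a = P x" | v where "v \<in> U" "a = P (x + v) + Fin (- g v)"
      by (auto simp: A_def)
    then show "c *\<^sub>R a \<in> A (c *\<^sub>R x)"
    proof cases
      case 1
      then show ?thesis using Pc[OF c x] by (simp add: A_def)
    next
      case 2
      then have "c *\<^sub>R a = P (c *\<^sub>R x + c *\<^sub>R v) + Fin (- g (c *\<^sub>R v))"
        using c Pc[OF c KaI[OF x UK]] gc[OF c]
        by (simp add: minf_ext_scaleR_add scaleR_add_right)
      then show ?thesis using UcI[OF c] 2 by (auto simp: A_def)
    qed
  next
    have mixed: "\<exists>d\<in>A (x + y). d \<le> P x + (P (y + v) + Fin (- g v))"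
      if "x \<in> K" "y \<in> K" "v \<in> U" for x y v
    proof (rule bexI)
      show "P (x + y + v) + Fin (- g v) \<in> A (x + y)" using that by (simp add: A_def)
      show "P (x + y + v) + Fin (- g v) \<le> P x + (P (y + v) + Fin (- g v))"
        using Pa[of x "y + v"] KaI UK that minf_ext_add_mono[OF _ order_refl]
        by (fastforce simp: add.assoc[symmetric])
    qed
    fix x y a b assume x: "x \<in> K" and y: "y \<in> K" and "a \<in> A x" "b \<in> A y"
    then consider "a = P x" "b = P y"
      | v where "v \<in> U" "a = P x" "b = P (y + v) + Fin (- g v)"
      | v where "v \<in> U" "a = P (x + v) + Fin (- g v)" "b = P y"
      | v w where "v \<in> U" "w \<in> U" "a = P (x + v) + Fin (- g v)" "b = P (y + w) + Fin (- g w)"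
      by (auto simp: A_def)
    then show "\<exists>d\<in>A (x + y). d \<le> a + b"
    proof cases
      case 1
      then show ?thesis using Pa[OF x y] by (auto simp: A_def)
    next
      case 2
      then show ?thesis using mixed[OF x y] by simp
    next
      case 3
      then show ?thesis using mixed[OF y x] by (simp add: add.commute)
    next
      case 4
      have "P ((x + v) + (y + w)) \<le> P (x + v) + P (y + w)"
        using 4 x y by (intro Pa) (auto intro: KaI UK)
      moreover have "Fin (- g (v + w)) \<le> Fin (- g v) + Fin (- g w)"
        using ga[OF 4(1,2)] by (simp add: algebra_simps)
      ultimately have "P ((x + v) + (y + w)) + Fin (- g (v + w))
          \<le> (P (x + v) + P (y + w)) + (Fin (- g v) + Fin (- g w))"
        by (rule minf_ext_add_mono)
      then have "P ((x + y) + (v + w)) + Fin (- g (v + w)) \<le> a + b"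
        unfolding 4(3,4) by (simp only: ac_simps)
      then show ?thesis using UaI[OF 4(1,2)] by (auto simp: A_def)
    qed
  qed (auto simp: A_def)
  \<comment> \<open>With \<open>g u\<close> moved to the other side, \<open>gT\<close> says that
    \<open>T x\<close> is below every shifted value.\<close>
  moreover have "T x \<le> minf_Inf (A x)" if "x \<in> K" for x
    using P gT that
    by (intro minf_Inf_greatest) (auto simp: A_def sublinear_above_def minf_ext_add_Fin_le_iff)
  ultimately have "sublinear_above K T (\<lambda>x. minf_Inf (A x))"
    by (simp add: sublinear_above_def)
  moreover have "\<forall>x\<in>K. minf_Inf (A x) \<le> P x" by (auto simp: A_def intro: minf_Inf_lower)
  ultimately have "\<forall>x\<in>K. P x \<le> minf_Inf (A x)" by (rule min)
  then have "P x \<le> minf_Inf (A x)" using x ..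
  also have "\<dots> \<le> P (x + u) + Fin (- g u)"
    using u by (intro minf_Inf_lower) (simp add: A_def)
  finally show ?thesis by (simp add: minf_ext_add_Fin_le_iff)
qed

text \<open>A bootstrap: \<open>T\<close> superadditive gives the mixed inequality
  \<open>step1\<close>, which is the compatibility condition needed to replace \<open>T\<close> by
  \<open>P\<close> in the second summand.\<close>

lemma minimal_sublinear_linear:
  fixes P T :: "'v::real_vector \<Rightarrow> 'w::{ordered_real_vector, conditionally_complete_lattice} minf_ext"
  assumes K: "is_convex_cone K"
    and minimal: "minimal_sublinear_above K T P"
    and Tc: "pos_homogeneous_on K T"
    and Ta: "\<And>x y. x \<in> K \<Longrightarrow> y \<in> K \<Longrightarrow> T x + T y \<le> T (x + y)"
  shows "rel_linear_on UNIV K P"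
proof -
  have P: "sublinear_above K T P"
    using minimal by (simp add: minimal_sublinear_above_def)
  note KcI = is_convex_cone_scaleR[OF K]
  note KaI = is_convex_cone_add[OF K]
  have Pc: "P (c *\<^sub>R x) = c *\<^sub>R P x" if "c > 0" "x \<in> K" for c x
    using P that by (auto simp: sublinear_above_def rel_sublinear_on_def pos_homogeneous_on_def)
  have TP: "T x \<le> P x" if "x \<in> K" for x using P that by (auto simp: sublinear_above_def)
  have Tc': "T (c *\<^sub>R x) = c *\<^sub>R T x" if "c > 0" "x \<in> K" for c x
    using Tc that by (auto simp: pos_homogeneous_on_def)
  have step1: "P x + T u \<le> P (x + u)" if x: "x \<in> K" and u: "u \<in> K" for x u
  proof (cases "T u")
    case (Fin t)
    \<comment> \<open>Only where \<open>T\<close> is finite can it be subtracted; superlinearity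
      makes this part of \<open>K\<close> a cone. If \<open>T u\<close> is \<open>MInf\<close>, the
      claim is trivial.\<close>
    define U where "U = {u\<in>K. T u \<noteq> MInf}"
    define g where "g u = (case T u of Fin t \<Rightarrow> t)" for u
    have T: "T v = Fin (g v)" if "v \<in> U" for v
      using that by (auto simp: U_def g_def split: minf_ext.split)
    have Uc: "c *\<^sub>R v \<in> U" if "c > 0" "v \<in> U" for c v
      using that T[of v] by (auto simp: U_def Tc' KcI)
    have Ua: "v + w \<in> U" if "v \<in> U" "w \<in> U" for v w
      using that T[of v] T[of w] Ta[of v w] by (auto simp: U_def KaI)
    have "P x + Fin (g u) \<le> P (x + u)"
    proof (rule minimal_sublinear_superadditive[OF K minimal, where U = U])
      show "is_convex_cone U" using Uc Ua by (auto simp: is_convex_cone_def)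
      show "g (c *\<^sub>R v) = c *\<^sub>R g v" if "c > 0" "v \<in> U" for c v
        using T[OF Uc[OF that]] T[OF that(2)] Tc'[of c v] that by (simp add: U_def)
      show "g v + g w \<le> g (v + w)" if "v \<in> U" "w \<in> U" for v w
        using T[OF Ua[OF that]] T[OF that(1)] T[OF that(2)] Ta[of v w] that by (simp add: U_def)
      show "T y + Fin (g v) \<le> P (y + v)" if "y \<in> K" "v \<in> U" for y v
        using T[OF that(2)] Ta[of y v] TP[of "y + v"] that KaI[of y v]
        by (force simp: U_def intro: order_trans)
    qed (use x u Fin in \<open>auto simp: U_def\<close>)
    then show ?thesis by (simp add: g_def Fin)
  qed simp
  have step2: "P x + P z \<le> P (x + z)" if x: "x \<in> K" and z: "z \<in> K" for x z
  proof (cases "P z")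
    case (Fin p)
    \<comment> \<open>On a ray, homogeneity alone makes \<open>P\<close> additive, whereas
      superadditivity of \<open>P\<close> on all of \<open>K\<close> is what is to be shown.\<close>
    define U where "U = (\<lambda>c. c *\<^sub>R z) ` {0<..}"
    define g where "g u = (case P u of Fin t \<Rightarrow> t)" for u
    have Pz: "P (c *\<^sub>R z) = Fin (c *\<^sub>R p)" if "c > 0" for c
      using Pc[OF that z] Fin by simp
    then have gz: "g (c *\<^sub>R z) = c *\<^sub>R p" if "c > 0" for c
      using that by (simp add: g_def)
    have "P x + Fin (g z) \<le> P (x + z)"
    proof (rule minimal_sublinear_superadditive[OF K minimal, where U = U])
      have "c *\<^sub>R z + d *\<^sub>R z \<in> U" if "c > 0" "d > 0" for c d
        using that by (auto simp: U_def scaleR_add_left[symmetric])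
      then show "is_convex_cone U" by (auto simp: is_convex_cone_def U_def)
      show "U \<subseteq> K" using z KcI by (auto simp: U_def)
      show "g (c *\<^sub>R v) = c *\<^sub>R g v" if "c > 0" "v \<in> U" for c v
        using that by (auto simp: U_def gz)
      show "g v + g w \<le> g (v + w)" if "v \<in> U" "w \<in> U" for v w
        using that by (auto simp: U_def gz scaleR_add_left[symmetric])
      \<comment> \<open>This is \<open>step1\<close> with the roles exchanged: \<open>P\<close> at
        the point of the ray, \<open>T\<close> at \<open>y\<close>.\<close>
      show "T y + Fin (g v) \<le> P (y + v)" if y: "y \<in> K" and v: "v \<in> U" for y v
      proof -
        obtain c where c: "c > 0" "v = c *\<^sub>R z" using v by (auto simp: U_def)
        then show ?thesis
          using step1[OF KcI[OF c(1) z] y] Pz[OF c(1)] gz[OF c(1)] by (simp add: add.commute)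
      qed
      show "z \<in> U" by (auto simp: U_def intro: image_eqI[of _ _ 1])
    qed (use x in auto)
    then show ?thesis by (simp add: g_def Fin)
  qed simp
  have "P (x + y) \<le> P x + P y" if "x \<in> K" "y \<in> K" for x y
    using P that by (auto simp: sublinear_above_def rel_sublinear_on_def)
  with step2 Pc show ?thesis
    by (auto simp: rel_linear_on_def pos_homogeneous_on_def intro: antisym)
qed

section \<open>The sandwich theorem on one convex cone\<close>

theorem cone_sandwich:
  fixes H T :: "'v::real_vector \<Rightarrow> 'w::{ordered_real_vector, conditionally_complete_lattice} minf_ext"
  assumes K: "is_convex_cone K"
    and H: "rel_sublinear_on UNIV K H"
    and Tc: "pos_homogeneous_on K T"
    and Ta: "\<And>x y. x \<in> K \<Longrightarrow> y \<in> K \<Longrightarrow> T x + T y \<le> T (x + y)"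
    and TH: "\<And>x. x \<in> K \<Longrightarrow> T x \<le> H x"
  shows "\<exists>Q. rel_linear_on UNIV K Q \<and> (\<forall>x\<in>K. T x \<le> Q x \<and> Q x \<le> H x)"
proof -
  \<comment> \<open>The values outside \<open>K\<close> are normalised so that the pointwise order only compares values on \<open>K\<close>.\<close>
  define cut where "cut P x = (if x \<in> K then P x else MInf)" for P :: "'v \<Rightarrow> 'w minf_ext" and x
  define \<A> where "\<A> = {P. sublinear_above K T P \<and> P \<le> cut H \<and> (\<forall>x. x \<notin> K \<longrightarrow> P x = MInf)}"
  note KcI = is_convex_cone_scaleR[OF K]
  note KaI = is_convex_cone_add[OF K]
  have cut: "sublinear_above K T (cut P)" if "sublinear_above K T P" for P
    using that KcI KaI
    by (auto simp: sublinear_above_def rel_sublinear_on_def pos_homogeneous_on_def cut_def)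
  have HA: "cut H \<in> \<A>"
    using cut[of H] H TH by (auto simp: \<A>_def sublinear_above_def cut_def)
  \<comment> \<open>Zorn's lemma is applied to the reversed order, so a chain needs a pointwise
    lower bound and the resulting element is minimal.\<close>
  have "\<exists>M\<in>\<A>. \<forall>P\<in>\<A>. P \<le> M \<longrightarrow> P = M"
  proof (rule predicate_Zorn)
    show "partial_order_on \<A> (relation_of (\<lambda>P R. R \<le> P) \<A>)"
      by (rule partial_order_on_relation_ofI) auto
  next
    fix \<C> assume "\<C> \<in> Chains (relation_of (\<lambda>P R. R \<le> P) \<A>)"
    then have CA: "\<C> \<subseteq> \<A>" and chain: "\<And>P R. P \<in> \<C> \<Longrightarrow> R \<in> \<C> \<Longrightarrow> R \<le> P \<or> P \<le> R"
      by (auto simp: Chains_def relation_of_def)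
    show "\<exists>L\<in>\<A>. \<forall>P\<in>\<C>. L \<le> P"
    proof (cases "\<C> = {}")
      case True
      then show ?thesis using HA by blast
    next
      case False
      define L where "L = cut (\<lambda>x. minf_Inf ((\<lambda>P. P x) ` \<C>))"
      have Psub: "rel_sublinear_on UNIV K P" "\<And>x. x \<in> K \<Longrightarrow> T x \<le> P x" "P \<le> cut H"
        "\<And>x. x \<notin> K \<Longrightarrow> P x = MInf" if "P \<in> \<C>" for P
        using that CA by (auto simp: \<A>_def sublinear_above_def)
      have LP: "L \<le> P" if "P \<in> \<C>" for P
        using that by (auto simp: le_fun_def L_def cut_def intro!: minf_Inf_lower)
      have "rel_sublinear_on UNIV K L"
      proof (rule rel_sublinear_on_minf_Inf[OF K, where A = "\<lambda>x. (\<lambda>P. P x) ` \<C>"])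
        fix c :: real and x a assume "c > 0" "x \<in> K" "a \<in> (\<lambda>P. P x) ` \<C>"
        then show "c *\<^sub>R a \<in> (\<lambda>P. P (c *\<^sub>R x)) ` \<C>"
          using Psub(1) by (force simp: rel_sublinear_on_def pos_homogeneous_on_def)
      next
        fix x y a b
        assume x: "x \<in> K" and y: "y \<in> K" and "a \<in> (\<lambda>P. P x) ` \<C>" "b \<in> (\<lambda>P. P y) ` \<C>"
        then obtain P R where PR: "P \<in> \<C>" "R \<in> \<C>" "a = P x" "b = R y" by blast
        \<comment> \<open>The smaller of the two maps serves for both arguments; this is where the
          chain property enters.\<close>
        obtain S where S: "S \<in> \<C>" "S \<le> P" "S \<le> R" using chain[OF PR(1,2)] PR by blast
        have "S (x + y) \<le> S x + S y"
          using Psub(1)[OF S(1)] x y by (auto simp: rel_sublinear_on_def)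
        also have "\<dots> \<le> a + b"
          unfolding PR(3,4) using S by (intro minf_ext_add_mono) (auto simp: le_fun_def)
        finally show "\<exists>d\<in>(\<lambda>P. P (x + y)) ` \<C>. d \<le> a + b" using S(1) by blast
      qed (use False in \<open>auto simp: L_def cut_def\<close>)
      moreover have "T x \<le> L x" if "x \<in> K" for x
        using that False Psub(2) by (auto simp: L_def cut_def intro!: minf_Inf_greatest)
      moreover have "L \<le> cut H" using False LP Psub(3) order_trans by blast
      ultimately have "L \<in> \<A>" by (auto simp: \<A>_def sublinear_above_def L_def cut_def)
      then show ?thesis using LP by blast
    qed
  qed
  then obtain M where M: "M \<in> \<A>" and min: "\<And>P. P \<in> \<A> \<Longrightarrow> P \<le> M \<Longrightarrow> P = M" by blast
  have M': "sublinear_above K T M" "M \<le> cut H" using M by (auto simp: \<A>_def)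
  \<comment> \<open>Minimality within \<open>\<A>\<close> extends to all competitors:
    \<open>cut R\<close> agrees with \<open>R\<close> on \<open>K\<close> and, lying below
    \<open>M\<close>, also lies below \<open>cut H\<close>.\<close>
  have "M x \<le> R x" if R: "sublinear_above K T R" "\<forall>x\<in>K. R x \<le> M x" and x: "x \<in> K" for R x
  proof -
    have "cut R \<le> M" using R(2) by (auto simp: le_fun_def cut_def)
    moreover from this have "cut R \<in> \<A>"
      using cut[OF R(1)] M'(2) by (auto simp: \<A>_def cut_def[of R])
    ultimately have "cut R = M" by (rule min[rotated])
    then show ?thesis using x by (auto simp: cut_def)
  qed
  with M'(1) have "minimal_sublinear_above K T M"
    by (simp add: minimal_sublinear_above_def)
  then have "rel_linear_on UNIV K M"
    using Ta by (intro minimal_sublinear_linear[OF K _ Tc])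
  moreover have "T x \<le> M x" "M x \<le> H x" if "x \<in> K" for x
    using M' that le_funD[OF M'(2), of x] by (auto simp: sublinear_above_def cut_def)
  ultimately show ?thesis by blast
qed

section \<open>Gluing over the classes of the relation\<close>

text \<open>Positive multiples of a point and sums of related points stay in one class of
  \<open>C\<close>, so maps that are linear on each class combine to a \<open>C\<close>-linear map
  on \<open>X\<close>.\<close>

theorem corollary1:
  fixes X Y :: "'v::ordered_real_vector set"
    and C :: "'v rel"
    and H l :: "'v \<Rightarrow> 'w::{ordered_real_vector, conditionally_complete_lattice} minf_ext"
  assumes "is_convex_cone X"
    and "convex_conic_sym_preorder X C"
    and "rel_sublinear_on C X H"
    and "mono_on X H"
    and "is_convex_cone Y"
    and "Y \<subseteq> X"
    and "rel_linear_on C Y l"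
    and "\<forall>y\<in>Y. l y \<le> H y"
  shows "\<exists>Q :: 'v \<Rightarrow> 'w minf_ext. rel_linear_on C X Q \<and>
           (\<forall>x\<in>X. Q x \<le> H x) \<and> (\<forall>y\<in>Y. l y \<le> Q y)"
proof -
  have CX: "C \<subseteq> X \<times> X" and trans: "trans C" and sym: "sym C"
    and refl: "\<And>x. x \<in> X \<Longrightarrow> (x, x) \<in> C"
    and Cc: "\<And>c x. x \<in> X \<Longrightarrow> c > 0 \<Longrightarrow> (c *\<^sub>R x, x) \<in> C"
    and Ca: "\<And>x y z. (x, y) \<in> C \<Longrightarrow> (y, z) \<in> C \<Longrightarrow> (x + y, z) \<in> C"
    using assms(2) unfolding convex_conic_sym_preorder_def refl_on_def by blast+
  \<comment> \<open>The value \<open>MInf\<close> off \<open>Y\<close> makes superadditivity trivial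
    whenever a summand lies outside \<open>Y\<close>. Homogeneity off \<open>Y\<close> holds because
    positive scaling also preserves the complement of \<open>Y\<close>, by
    \<open>Yc\<close>.\<close>
  define T where "T x = (if x \<in> Y then l x else MInf)" for x
  have Yc: "c *\<^sub>R y \<in> Y \<longleftrightarrow> y \<in> Y" if "c > 0" for c y
  proof
    assume "c *\<^sub>R y \<in> Y"
    then have "inverse c *\<^sub>R c *\<^sub>R y \<in> Y"
      using assms(5) that unfolding is_convex_cone_def by (meson positive_imp_inverse_positive)
    then show "y \<in> Y" using that by simp
  qed (use assms(5) that in \<open>auto simp: is_convex_cone_def\<close>)
  \<comment> \<open>Any two points of a class are related, so within it
    \<open>C\<close>-sublinearity is plain sublinearity.\<close>
  have "\<exists>Q. rel_linear_on UNIV (C `` {x}) Q \<and> (\<forall>u\<in>C `` {x}. T u \<le> Q u \<and> Q u \<le> H u)" for x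
  proof -
    let ?K = "C `` {x}"
    have KX: "?K \<subseteq> X" using CX by blast
    have KC: "(u, v) \<in> C" if "u \<in> ?K" "v \<in> ?K" for u v
      using that trans sym by (meson Image_singleton_iff symD transD)
    have "c *\<^sub>R u \<in> ?K" if "c > 0" "u \<in> ?K" for c u
      using that KX Cc[of u c] trans sym by (meson Image_singleton_iff symD transD subsetD)
    moreover have "u + v \<in> ?K" if "u \<in> ?K" "v \<in> ?K" for u v
      using that Ca[OF KC[OF that], of x] sym by (meson Image_singleton_iff symD)
    ultimately have K: "is_convex_cone ?K" by (simp add: is_convex_cone_def)
    have "rel_sublinear_on UNIV ?K H"
      using assms(3) KX KC by (auto simp: rel_sublinear_on_def pos_homogeneous_on_def subset_iff)
    moreover have "pos_homogeneous_on ?K T"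
      using assms(7) Yc by (auto simp: rel_linear_on_def pos_homogeneous_on_def T_def)
    moreover have "T u + T v \<le> T (u + v)" if "u \<in> ?K" "v \<in> ?K" for u v
      using assms(5,7) KC[OF that] by (auto simp: rel_linear_on_def is_convex_cone_def T_def)
    moreover have "T u \<le> H u" for u using assms(8) by (simp add: T_def)
    ultimately show ?thesis by (intro cone_sandwich K)
  qed
  \<comment> \<open>The choice is indexed by the class itself, not by a representative, so that
    related points receive the same map.\<close>
  then have "\<exists>Q. rel_linear_on UNIV K Q \<and> (\<forall>u\<in>K. T u \<le> Q u \<and> Q u \<le> H u)"
    if "K \<in> range (\<lambda>x. C `` {x})" for K using that by blast
  then obtain q where q: "\<And>x. rel_linear_on UNIV (C `` {x}) (q (C `` {x}))"
      "\<And>x u. u \<in> C `` {x} \<Longrightarrow> T u \<le> q (C `` {x}) u \<and> q (C `` {x}) u \<le> H u"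
    by (metis rangeI)
  define Q where "Q x = q (C `` {x}) x" for x
  have same: "C `` {x} = C `` {y}" if "(x, y) \<in> C" for x y
    using that trans sym by (auto dest: symD transD)
  have "Q (c *\<^sub>R x) = c *\<^sub>R Q x" if "c > 0" "x \<in> X" for c x
    using q(1)[of x] refl[OF that(2)] same[OF Cc[OF that(2,1)]] that
    by (simp add: Q_def rel_linear_on_def pos_homogeneous_on_def)
  moreover have "Q (x + y) = Q x + Q y" if "(x, y) \<in> C" for x y
  proof -
    have "(y, y) \<in> C" using that CX refl by blast
    then have "C `` {x + y} = C `` {y}" using same Ca that by blast
    moreover have "x \<in> C `` {y}" using that sym by (auto dest: symD)
    ultimately show ?thesis
      using q(1)[of y] same[OF that] \<open>(y, y) \<in> C\<close> by (simp add: Q_def rel_linear_on_def)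
  qed
  ultimately have "rel_linear_on C X Q"
    by (simp add: rel_linear_on_def pos_homogeneous_on_def)
  moreover have "T x \<le> Q x" "Q x \<le> H x" if "x \<in> X" for x
    using q(2)[of x x] refl[OF that] by (auto simp: Q_def)
  ultimately show ?thesis using assms(6) by (force simp: T_def)
qed

end
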